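(* Let $p\in\mathbb N$ and let $(\mathbf A_n)_{n\in\mathbb N}$ be a sequence of finite $L$-structures. For each $n$ let $\mathbf B_n$ be the structure obtained from $\mathbf A_n$ by attaching $n$ new leaves to each vertex, all new leaves being marked by a distinct (new unary) symbol. Then $(\mathbf A_n)_n$ is $\mathrm{FO}_p$-convergent if and only if $(\mathbf B_n)_n$ is $\mathrm{FO}_p$-convergent.
   Context: $L$ is a purely relational first-order language with equality and finite positive arities. All structures are finite and nonempty. $\mathbf B_n$ is a structure in the language $L\cup\{E,M\}$, where $E$ is a binary symbol (new, or already in $L$) and $M\notin L$ is a new unary symbol: its universe is $V(\mathbf A_n)$ together with $n$ new vertices for each $v\in V(\mathbf A_n)$ (all distinct); each new vertex attached to $v$ is joined to $v$ by an undirected $E$-edge (both ordered pairs), $M$ holds exactly for the new vertices, and otherwise the relations are those of $\mathbf A_n$. $\mathrm{FO}_p$ is the set of first-order formulas (of the language in question) with free variables among $x_1,\dots,x_p$ (sentences are included, as formulas with dummy variables). $\langle\phi,\mathbf A\rangle$ is the probability that a uniformly random $p$-tuple of vertices of $\mathbf A$ satisfies $\phi$ ($1$ or $0$ according to truth for sentences). A sequence $(\mathbf A_n)_n$ is $\mathrm{FO}_p$-convergent if $\langle\phi,\mathbf A_n\rangle$ converges for each $\phi\in\mathrm{FO}_p$. *)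

theory Defs
  imports Complex_Main "HOL-Library.FuncSet"
begin

text \<open>A relational language is a set \<open>L\<close> of symbols, taken from an ambient type \<open>'r\<close>,
  together with an arity function on that type. The ambient type leaves room for symbols
  outside \<open>L\<close>, so that \<open>L\<close> can be extended.\<close>

record ('a, 'r) rel_struct =
  verts :: "'a set"
  interp :: "'r \<Rightarrow> 'a list set"

text \<open>The interpretation of symbols outside \<open>L\<close> is not constrained, and is never consulted.\<close>

definition finite_struct :: "'r set \<Rightarrow> ('r \<Rightarrow> nat) \<Rightarrow> ('a, 'r) rel_struct \<Rightarrow> bool" where
  "finite_struct L ar A \<longleftrightarrow>
     finite (verts A) \<and> verts A \<noteq> {} \<and>
     (\<forall>R\<in>L. interp A R \<subseteq> {vs. length vs = ar R \<and> set vs \<subseteq> verts A})"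

datatype 'r fm =
    Eq nat nat
  | Rel 'r "nat list"
  | Neg "'r fm"
  | Conj "'r fm" "'r fm"
  | Ex nat "'r fm"

primrec free_vars :: "'r fm \<Rightarrow> nat set" where
  "free_vars (Eq x y) = {x, y}"
| "free_vars (Rel R xs) = set xs"
| "free_vars (Neg \<phi>) = free_vars \<phi>"
| "free_vars (Conj \<phi> \<psi>) = free_vars \<phi> \<union> free_vars \<psi>"
| "free_vars (Ex x \<phi>) = free_vars \<phi> - {x}"

primrec formula_of :: "'r set \<Rightarrow> ('r \<Rightarrow> nat) \<Rightarrow> 'r fm \<Rightarrow> bool" where
  "formula_of L ar (Eq x y) \<longleftrightarrow> True"
| "formula_of L ar (Rel R xs) \<longleftrightarrow> R \<in> L \<and> length xs = ar R"
| "formula_of L ar (Neg \<phi>) \<longleftrightarrow> formula_of L ar \<phi>"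
| "formula_of L ar (Conj \<phi> \<psi>) \<longleftrightarrow> formula_of L ar \<phi> \<and> formula_of L ar \<psi>"
| "formula_of L ar (Ex x \<phi>) \<longleftrightarrow> formula_of L ar \<phi>"

primrec sat :: "('a, 'r) rel_struct \<Rightarrow> (nat \<Rightarrow> 'a) \<Rightarrow> 'r fm \<Rightarrow> bool" where
  "sat A e (Eq x y) \<longleftrightarrow> e x = e y"
| "sat A e (Rel R xs) \<longleftrightarrow> map e xs \<in> interp A R"
| "sat A e (Neg \<phi>) \<longleftrightarrow> \<not> sat A e \<phi>"
| "sat A e (Conj \<phi> \<psi>) \<longleftrightarrow> sat A e \<phi> \<and> sat A e \<psi>"
| "sat A e (Ex x \<phi>) \<longleftrightarrow> (\<exists>v\<in>verts A. sat A (e(x := v)) \<phi>)"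

definition FO :: "'r set \<Rightarrow> ('r \<Rightarrow> nat) \<Rightarrow> nat \<Rightarrow> 'r fm set" where
  "FO L ar p = {\<phi>. formula_of L ar \<phi> \<and> free_vars \<phi> \<subseteq> {1..p}}"

text \<open>A \<open>p\<close>-tuple of vertices is a function on \<open>{1..p}\<close>, used directly as the assignment of
  \<open>x\<^sub>1, \<dots>, x\<^sub>p\<close>. For \<open>p = 0\<close> there is exactly one (empty) tuple, so the pairing of a sentence
  is \<open>1\<close> or \<open>0\<close>.\<close>

definition pairing :: "nat \<Rightarrow> 'r fm \<Rightarrow> ('a, 'r) rel_struct \<Rightarrow> real" where
  "pairing p \<phi> A =
     real (card {t \<in> {1..p} \<rightarrow>\<^sub>E verts A. sat A t \<phi>}) / real (card ({1..p} \<rightarrow>\<^sub>E verts A))"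

definition FO_convergent ::
    "'r set \<Rightarrow> ('r \<Rightarrow> nat) \<Rightarrow> nat \<Rightarrow> (nat \<Rightarrow> ('a, 'r) rel_struct) \<Rightarrow> bool" where
  "FO_convergent L ar p A \<longleftrightarrow> (\<forall>\<phi>\<in>FO L ar p. convergent (\<lambda>n. pairing p \<phi> (A n)))"

text \<open>\<open>Inl v\<close> is the vertex \<open>v\<close> of the \<open>L\<close>-structure \<open>A\<close>, and \<open>Inr (v, i)\<close> with \<open>i < n\<close> are the
  leaves attached to \<open>v\<close>. If \<open>E \<in> L\<close>, the new edges are added to the \<open>E\<close>-relation of \<open>A\<close>;
  otherwise they are the only \<open>E\<close>-edges.\<close>

definition attach_leaves ::
    "'r set \<Rightarrow> 'r \<Rightarrow> 'r \<Rightarrow> nat \<Rightarrow> ('a, 'r) rel_struct \<Rightarrow> ('a + 'a \<times> nat, 'r) rel_struct" where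
  "attach_leaves L E M n A =
     \<lparr>verts = Inl ` verts A \<union> Inr ` (verts A \<times> {..<n}),
      interp = (\<lambda>R.
        (if R \<in> L then map Inl ` interp A R else {}) \<union>
        (if R = E then (\<Union>v\<in>verts A. \<Union>i<n. {[Inl v, Inr (v, i)], [Inr (v, i), Inl v]}) else {}) \<union>
        (if R = M then (\<Union>v\<in>verts A. \<Union>i<n. {[Inr (v, i)]}) else {}))\<rparr>"

lemma finite_struct_attach_leaves:
  assumes "finite_struct L ar A" and "ar E = 2" and "ar M = 1"
  shows "finite_struct (L \<union> {E, M}) ar (attach_leaves L E M n A)"
proof -
  let ?B = "attach_leaves L E M n A"
  have L: "length vs = ar R \<and> set vs \<subseteq> verts A" if "R \<in> L" "vs \<in> interp A R" for R vs
    using assms(1) that unfolding finite_struct_def by blast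
  have "length ws = ar R \<and> set ws \<subseteq> verts ?B" if ws: "ws \<in> interp ?B R" for R ws
  proof -
    from ws consider vs where "R \<in> L" "vs \<in> interp A R" "ws = map Inl vs"
      | v i where "R = E" "v \<in> verts A" "i < n" "ws = [Inl v, Inr (v, i)] \<or> ws = [Inr (v, i), Inl v]"
      | v i where "R = M" "v \<in> verts A" "i < n" "ws = [Inr (v, i)]"
      unfolding attach_leaves_def by (auto split: if_split_asm)
    then show ?thesis
    proof cases
      case 1
      then show ?thesis using L[of R vs] by (auto simp: attach_leaves_def)
    next
      case 2
      then show ?thesis using assms(2) by (elim disjE) (simp_all add: attach_leaves_def)
    next
      case 3
      then show ?thesis using assms(3) by (simp add: attach_leaves_def)
    qed
  qed
  moreover have "finite (verts ?B)" "verts ?B \<noteq> {}"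
    using assms(1) by (simp_all add: finite_struct_def attach_leaves_def)
  ultimately show ?thesis unfolding finite_struct_def by blast
qed

lemma sat_cong: "(\<And>x. x \<in> free_vars \<phi> \<Longrightarrow> e x = e' x) \<Longrightarrow> sat A e \<phi> \<longleftrightarrow> sat A e' \<phi>"
proof (induction \<phi> arbitrary: e e')
  case (Rel R xs)
  have "map e xs = map e' xs" by (rule map_cong[OF refl]) (use Rel.prems in simp)
  then show ?case by (simp only: sat.simps)
next
  case (Conj \<phi> \<psi>)
  have "sat A e \<phi> \<longleftrightarrow> sat A e' \<phi>" by (rule Conj.IH) (use Conj.prems in auto)
  moreover have "sat A e \<psi> \<longleftrightarrow> sat A e' \<psi>" by (rule Conj.IH) (use Conj.prems in auto)
  ultimately show ?case by simp
next
  case (Ex x \<phi>)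
  have "sat A (e(x := v)) \<phi> \<longleftrightarrow> sat A (e'(x := v)) \<phi>" for v
    by (rule Ex.IH) (use Ex.prems in auto)
  then show ?case by simp
next
  case (Neg \<phi>)
  have "sat A e \<phi> \<longleftrightarrow> sat A e' \<phi>" by (rule Neg.IH) (use Neg.prems in simp)
  then show ?case by simp
next
  case (Eq x y)
  have "e x = e' x" "e y = e' y" using Eq.prems by auto
  then show ?case by simp
qed

end

theory Submission
  imports Defs
begin

text \<open>Call a tuple of vertices of \<open>B\<^sub>n\<close> a leaf tuple if it consists of leaves whose positions
  below their base vertices are pairwise distinct. A uniformly random tuple of \<open>B\<^sub>n\<close> is a leaf tuple
  with probability tending to one, and the bases of a random leaf tuple are a uniformly random
  tuple of \<open>A\<^sub>n\<close>. It remains to translate formulas in both directions so that satisfaction by leaf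
  tuples corresponds to satisfaction by their bases. A formula about \<open>A\<^sub>n\<close> is relativized to the
  unmarked vertices and evaluated after moving each variable along \<open>E\<close>, from a leaf to its base.
  For a formula about \<open>B\<^sub>n\<close> with at most \<open>N\<close> variables, every embedding of \<open>B\<^sub>N\<close> into \<open>B\<^sub>n\<close> that
  injectively relabels the leaf positions is elementary; and over \<open>B\<^sub>N\<close>, where \<open>N\<close> no longer
  depends on \<open>n\<close>, the quantifier over positions becomes a finite disjunction.\<close>

subsection \<open>Formulas\<close>

primrec vars :: "'r fm \<Rightarrow> nat set" where
  "vars (Eq x y) = {x, y}"
| "vars (Rel R xs) = set xs"
| "vars (Neg \<phi>) = vars \<phi>"
| "vars (Conj \<phi> \<psi>) = vars \<phi> \<union> vars \<psi>"
| "vars (Ex x \<phi>) = insert x (vars \<phi>)"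

lemma finite_vars [simp]: "finite (vars \<phi>)"
  by (induction \<phi>) auto

lemma free_vars_subset_vars: "free_vars \<phi> \<subseteq> vars \<phi>"
  by (induction \<phi>) auto

lemma finite_free_vars [simp]: "finite (free_vars \<phi>)"
  using finite_subset[OF free_vars_subset_vars] by simp

lemma card_free_vars_Ex_less: "card (free_vars (Ex x \<phi>)) < card (vars (Ex x \<phi>))"
  by (rule psubset_card_mono) (use free_vars_subset_vars in fastforce)+

definition Falsum :: "'r fm" where
  "Falsum = Ex 0 (Neg (Eq 0 0))"

lemma Falsum_simps [simp]:
  "formula_of L ar Falsum" "free_vars Falsum = {}" "\<not> sat A e Falsum"
  by (simp_all add: Falsum_def)

definition Disj :: "'r fm list \<Rightarrow> 'r fm" where
  "Disj \<phi>s = foldr (\<lambda>\<phi> \<psi>. Neg (Conj (Neg \<phi>) (Neg \<psi>))) \<phi>s Falsum"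

lemma formula_of_Disj [simp]: "formula_of L ar (Disj \<phi>s) \<longleftrightarrow> (\<forall>\<phi>\<in>set \<phi>s. formula_of L ar \<phi>)"
  by (induction \<phi>s) (simp_all add: Disj_def)

lemma free_vars_Disj [simp]: "free_vars (Disj \<phi>s) = (\<Union>\<phi>\<in>set \<phi>s. free_vars \<phi>)"
  by (induction \<phi>s) (simp_all add: Disj_def)

lemma sat_Disj [simp]: "sat A e (Disj \<phi>s) \<longleftrightarrow> (\<exists>\<phi>\<in>set \<phi>s. sat A e \<phi>)"
  by (induction \<phi>s) (simp_all add: Disj_def)

primrec relativize_unmarked :: "'r \<Rightarrow> 'r fm \<Rightarrow> 'r fm" where
  "relativize_unmarked M (Eq x y) = Eq x y"
| "relativize_unmarked M (Rel R xs) = Rel R xs"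
| "relativize_unmarked M (Neg \<phi>) = Neg (relativize_unmarked M \<phi>)"
| "relativize_unmarked M (Conj \<phi> \<psi>) = Conj (relativize_unmarked M \<phi>) (relativize_unmarked M \<psi>)"
| "relativize_unmarked M (Ex x \<phi>) = Ex x (Conj (Neg (Rel M [x])) (relativize_unmarked M \<phi>))"

lemma formula_of_relativize_unmarked:
  "formula_of L ar \<phi> \<Longrightarrow> L \<subseteq> L' \<Longrightarrow> M \<in> L' \<Longrightarrow> ar M = 1 \<Longrightarrow>
    formula_of L' ar (relativize_unmarked M \<phi>)"
  by (induction \<phi>) auto

lemma free_vars_relativize_unmarked [simp]: "free_vars (relativize_unmarked M \<phi>) = free_vars \<phi>"
  by (induction \<phi>) auto

lemma sat_relativize_unmarked:
  assumes "inj h"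
    and unmarked: "{w \<in> verts B. [w] \<notin> interp B M} = h ` verts A"
    and rels: "\<And>R vs. R \<in> L \<Longrightarrow> map h vs \<in> interp B R \<longleftrightarrow> vs \<in> interp A R"
  shows "formula_of L ar \<phi> \<Longrightarrow> sat B (h \<circ> r) (relativize_unmarked M \<phi>) \<longleftrightarrow> sat A r \<phi>"
proof (induction \<phi> arbitrary: r)
  case (Eq x y)
  show ?case using injD[OF \<open>inj h\<close>] by auto
next
  case (Rel R xs)
  then show ?case using rels[of R "map r xs"] by (simp add: comp_def)
next
  case (Ex x \<phi>)
  have "sat B (h \<circ> r) (relativize_unmarked M (Ex x \<phi>)) \<longleftrightarrow>
      (\<exists>w\<in>{w \<in> verts B. [w] \<notin> interp B M}. sat B ((h \<circ> r)(x := w)) (relativize_unmarked M \<phi>))"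
    by auto
  also have "\<dots> \<longleftrightarrow> (\<exists>v\<in>verts A. sat B (h \<circ> r(x := v)) (relativize_unmarked M \<phi>))"
    unfolding unmarked by (simp add: fun_upd_comp)
  also have "\<dots> \<longleftrightarrow> (\<exists>v\<in>verts A. sat A (r(x := v)) \<phi>)"
    using Ex.prems by (simp only: Ex.IH formula_of.simps)
  also have "\<dots> \<longleftrightarrow> sat A r (Ex x \<phi>)"
    by simp
  finally show ?case .
qed simp_all

text \<open>The auxiliary variable \<open>y\<close> carries the new value past the rebinding of \<open>x\<close>, so that
  no substitution is needed.\<close>

definition along :: "'r \<Rightarrow> nat \<Rightarrow> nat \<Rightarrow> 'r fm \<Rightarrow> 'r fm" where
  "along E y x \<phi> = Ex y (Conj (Rel E [x, y]) (Ex x (Conj (Eq x y) \<phi>)))"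

lemma formula_of_foldr_along:
  "formula_of L ar \<phi> \<Longrightarrow> E \<in> L \<Longrightarrow> ar E = 2 \<Longrightarrow> formula_of L ar (foldr (along E y) xs \<phi>)"
  by (induction xs) (simp_all add: along_def)

lemma free_vars_foldr_along:
  "y \<notin> set xs \<Longrightarrow> y \<notin> free_vars \<phi> \<Longrightarrow>
    free_vars (foldr (along E y) xs \<phi>) = set xs \<union> free_vars \<phi>"
  by (induction xs) (auto simp: along_def)

lemma sat_along:
  assumes "x \<noteq> y" and "y \<notin> free_vars \<phi>"
  shows "sat A e (along E y x \<phi>) \<longleftrightarrow>
    (\<exists>v\<in>verts A. [e x, v] \<in> interp A E \<and> sat A (e(x := v)) \<phi>)"
proof -
  have "sat A (e(y := v, x := v)) \<phi> \<longleftrightarrow> sat A (e(x := v)) \<phi>" for v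
    by (rule sat_cong) (use assms(2) in auto)
  then show ?thesis using assms(1) by (auto simp: along_def)
qed

lemma sat_foldr_along:
  assumes "y \<notin> set xs" and y: "y \<notin> free_vars \<phi>" and "distinct xs"
    and "\<And>x. x \<in> set xs \<Longrightarrow> {v \<in> verts A. [e x, v] \<in> interp A E} = {s x}"
  shows "sat A e (foldr (along E y) xs \<phi>) \<longleftrightarrow> sat A (override_on e s (set xs)) \<phi>"
  using assms(1,3,4)
proof (induction xs arbitrary: e)
  case (Cons x xs)
  have target: "{v \<in> verts A. [e x, v] \<in> interp A E} = {s x}" using Cons.prems(3) by simp
  have "y \<notin> free_vars (foldr (along E y) xs \<phi>)"
    using free_vars_foldr_along Cons.prems(1) y by fastforce
  then have "sat A e (foldr (along E y) (x # xs) \<phi>) \<longleftrightarrow>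
      (\<exists>v\<in>{v \<in> verts A. [e x, v] \<in> interp A E}. sat A (e(x := v)) (foldr (along E y) xs \<phi>))"
    using Cons.prems(1) by (simp add: sat_along) blast
  also have "\<dots> \<longleftrightarrow> sat A (e(x := s x)) (foldr (along E y) xs \<phi>)"
    unfolding target by simp
  also have "\<dots> \<longleftrightarrow> sat A (override_on (e(x := s x)) s (set xs)) \<phi>"
    by (rule Cons.IH) (use Cons.prems in auto)
  finally show ?case by (simp add: override_on_insert')
qed simp

subsection \<open>Attached leaves\<close>

definition distinct_positions :: "nat \<Rightarrow> nat \<Rightarrow> (nat \<Rightarrow> nat) set" where
  "distinct_positions p n = {k \<in> {1..p} \<rightarrow>\<^sub>E {..<n}. inj_on k {1..p}}"

definition leaf_tuple :: "nat \<Rightarrow> (nat \<Rightarrow> 'a) \<Rightarrow> (nat \<Rightarrow> nat) \<Rightarrow> nat \<Rightarrow> 'a + 'a \<times> nat" where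
  "leaf_tuple p r k = (\<lambda>x\<in>{1..p}. Inr (r x, k x))"

lemma inj_on_leaf_tuple:
  "inj_on (\<lambda>(r, k). leaf_tuple p r k) (({1..p} \<rightarrow>\<^sub>E V) \<times> ({1..p} \<rightarrow>\<^sub>E I))"
proof (rule inj_onI, clarify)
  fix r k r' k' assume "r \<in> {1..p} \<rightarrow>\<^sub>E V" "r' \<in> {1..p} \<rightarrow>\<^sub>E V"
    "k \<in> {1..p} \<rightarrow>\<^sub>E I" "k' \<in> {1..p} \<rightarrow>\<^sub>E I"
  moreover assume eq: "leaf_tuple p r k = leaf_tuple p r' k'"
  have "r x = r' x \<and> k x = k' x" if "x \<in> {1..p}" for x
    using fun_cong[OF eq, of x] that by (simp add: leaf_tuple_def)
  ultimately show "r = r' \<and> k = k'" by (metis PiE_ext)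
qed

locale leaf_language =
  fixes L :: "'r set" and ar :: "'r \<Rightarrow> nat" and E M :: 'r
  assumes ar_E: "ar E = 2" and ar_M: "ar M = 1" and M_notin_L: "M \<notin> L"
begin

abbreviation attach :: "nat \<Rightarrow> ('a, 'r) rel_struct \<Rightarrow> ('a + 'a \<times> nat, 'r) rel_struct" where
  "attach \<equiv> attach_leaves L E M"

lemma E_neq_M: "E \<noteq> M"
  using ar_E ar_M by auto

lemma Inl_in_verts_attach [simp]: "Inl v \<in> verts (attach n A) \<longleftrightarrow> v \<in> verts A"
  and Inr_in_verts_attach [simp]: "Inr (v, i) \<in> verts (attach n A) \<longleftrightarrow> v \<in> verts A \<and> i < n"
  by (auto simp: attach_leaves_def)

lemma in_interp_attach_iff:
  "ws \<in> interp (attach n A) R \<longleftrightarrow>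
    R \<in> L \<and> (\<exists>vs\<in>interp A R. ws = map Inl vs) \<or>
    R = E \<and> (\<exists>v\<in>verts A. \<exists>i<n. ws = [Inl v, Inr (v, i)] \<or> ws = [Inr (v, i), Inl v]) \<or>
    R = M \<and> (\<exists>v\<in>verts A. \<exists>i<n. ws = [Inr (v, i)])"
  by (auto simp: attach_leaves_def)

lemma card_verts_attach: "card (verts (attach n A)) = card (verts A) * Suc n"
proof (cases "finite (verts A)")
  case True
  have "card (verts (attach n A)) =
      card (Inl ` verts A :: ('a + 'a \<times> nat) set) +
      card (Inr ` (verts A \<times> {..<n}) :: ('a + 'a \<times> nat) set)"
    unfolding attach_leaves_def rel_struct.simps by (rule card_Un_disjoint) (use True in auto)
  then show ?thesis by (simp add: card_image card_cartesian_product)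
next
  case False
  then have "infinite (Inl ` verts A :: ('a + 'a \<times> nat) set)" by (simp add: finite_image_iff)
  then show ?thesis using False by (simp add: attach_leaves_def)
qed

lemma leaf_tuple_in_verts:
  "r \<in> {1..p} \<rightarrow>\<^sub>E verts A \<Longrightarrow> k \<in> {1..p} \<rightarrow>\<^sub>E {..<n} \<Longrightarrow>
    leaf_tuple p r k \<in> {1..p} \<rightarrow>\<^sub>E verts (attach n A)"
  by (simp add: leaf_tuple_def PiE_iff)

definition reads_bases :: "nat \<Rightarrow> nat \<Rightarrow> ('a, 'r) rel_struct \<Rightarrow> 'r fm \<Rightarrow> 'r fm \<Rightarrow> bool" where
  "reads_bases p n A \<psi> \<phi> \<longleftrightarrow> (\<forall>r\<in>{1..p} \<rightarrow>\<^sub>E verts A. \<forall>k\<in>distinct_positions p n.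
     sat (attach n A) (leaf_tuple p r k) \<psi> \<longleftrightarrow> sat A r \<phi>)"

subsection \<open>Reading the base structure off a leaf tuple\<close>

text \<open>The variable \<open>0\<close> is never free in a formula of \<open>FO L ar p\<close>.\<close>

definition base_formula :: "nat \<Rightarrow> 'r fm \<Rightarrow> 'r fm" where
  "base_formula p \<phi> = foldr (along E 0) [1..<Suc p] (relativize_unmarked M \<phi>)"

lemma base_formula_in_FO:
  assumes "\<phi> \<in> FO L ar p"
  shows "base_formula p \<phi> \<in> FO (L \<union> {E, M}) ar p"
proof -
  have \<phi>: "formula_of L ar \<phi>" "free_vars \<phi> \<subseteq> {1..p}" using assms by (simp_all add: FO_def)
  have "formula_of (L \<union> {E, M}) ar (base_formula p \<phi>)"
    unfolding base_formula_def using \<phi>(1) ar_E ar_M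
    by (intro formula_of_foldr_along formula_of_relativize_unmarked[of L]) auto
  moreover have "free_vars (base_formula p \<phi>) = {1..p} \<union> free_vars \<phi>"
    unfolding base_formula_def using \<phi>(2)
    by (subst free_vars_foldr_along) (auto simp del: upt_Suc)
  ultimately show ?thesis using \<phi>(2) by (simp add: FO_def)
qed

lemma sat_relativize_unmarked_attach:
  assumes "formula_of L ar \<phi>"
  shows "sat (attach n A) (Inl \<circ> r) (relativize_unmarked M \<phi>) \<longleftrightarrow> sat A r \<phi>"
proof (rule sat_relativize_unmarked[OF inj_Inl _ _ assms])
  show "{w \<in> verts (attach n A). [w] \<notin> interp (attach n A) M} = Inl ` verts A"
    using M_notin_L by (auto simp: attach_leaves_def)
  show "map Inl vs \<in> interp (attach n A) R \<longleftrightarrow> vs \<in> interp A R" if "R \<in> L" for R vs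
    using that by (auto simp: in_interp_attach_iff map_eq_Cons_conv)
qed

lemma reads_bases_base_formula:
  assumes \<phi>: "\<phi> \<in> FO L ar p"
  shows "reads_bases p n A (base_formula p \<phi>) \<phi>"
  unfolding reads_bases_def
proof (intro ballI)
  fix r k assume r: "r \<in> {1..p} \<rightarrow>\<^sub>E verts A" and "k \<in> distinct_positions p n"
  then have k: "k \<in> {1..p} \<rightarrow>\<^sub>E {..<n}" by (simp add: distinct_positions_def)
  have fv: "free_vars \<phi> \<subseteq> {1..p}" and lang: "formula_of L ar \<phi>" using \<phi> by (simp_all add: FO_def)
  have base: "{w \<in> verts (attach n A). [leaf_tuple p r k x, w] \<in> interp (attach n A) E} = {Inl (r x)}"
    if x: "x \<in> {1..p}" for x
  proof -
    have "r x \<in> verts A" "k x < n" using r k x by auto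
    then show ?thesis
      using x E_neq_M by (auto simp: leaf_tuple_def in_interp_attach_iff Cons_eq_map_conv)
  qed
  have "sat (attach n A) (leaf_tuple p r k) (base_formula p \<phi>) \<longleftrightarrow>
      sat (attach n A) (override_on (leaf_tuple p r k) (Inl \<circ> r) (set [1..<Suc p]))
        (relativize_unmarked M \<phi>)"
    unfolding base_formula_def
    by (rule sat_foldr_along) (use fv base in \<open>auto simp del: upt_Suc\<close>)
  also have "\<dots> \<longleftrightarrow> sat (attach n A) (Inl \<circ> r) (relativize_unmarked M \<phi>)"
    by (rule sat_cong) (use fv in \<open>auto simp: override_on_def\<close>)
  also have "\<dots> \<longleftrightarrow> sat A r \<phi>"
    by (rule sat_relativize_unmarked_attach[OF lang])
  finally show "sat (attach n A) (leaf_tuple p r k) (base_formula p \<phi>) \<longleftrightarrow> sat A r \<phi>" .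
qed

subsection \<open>Relabelling leaf positions\<close>

lemma ex_less_notin_image:
  assumes "finite X" and "card X < N"
  shows "\<exists>i<N. i \<notin> f ` X"
proof (rule ccontr)
  assume "\<not> ?thesis"
  then have "card {..<N} \<le> card (f ` X)" by (intro card_mono) (use assms(1) in auto)
  then show False using card_image_le[OF assms(1), of f] assms(2) by simp
qed

lemma inj_on_extend:
  assumes f: "inj_on f S" "f \<in> S \<rightarrow> B" and "S \<subseteq> A"
    and fin: "finite A" "finite B" "card A \<le> card B"
  obtains g where "inj_on g A" "g \<in> A \<rightarrow> B" "\<And>x. x \<in> S \<Longrightarrow> g x = f x"
proof -
  have "finite S" "f ` S \<subseteq> B" using f(2) finite_subset[OF \<open>S \<subseteq> A\<close>] fin(1) by auto
  then have "card (A - S) \<le> card (B - f ` S)"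
    using \<open>S \<subseteq> A\<close> fin(3) by (simp add: card_Diff_subset card_image[OF f(1)])
  then obtain h where h: "h ` (A - S) \<subseteq> B - f ` S" "inj_on h (A - S)"
    using card_le_inj[of "A - S" "B - f ` S"] fin by auto
  let ?g = "\<lambda>x. if x \<in> S then f x else h x"
  have "inj_on ?g (S \<union> (A - S))"
    by (rule inj_on_disjoint_Un) (use f(1) h in auto)
  moreover have "S \<union> (A - S) = A" using \<open>S \<subseteq> A\<close> by blast
  moreover have "?g \<in> A \<rightarrow> B" using f(2) h(1) by (simp add: Pi_iff image_subset_iff)
  ultimately show ?thesis using that[of ?g] by simp
qed

definition relabel :: "(nat \<Rightarrow> nat) \<Rightarrow> 'a + 'a \<times> nat \<Rightarrow> 'a + 'a \<times> nat" where
  "relabel \<sigma> = map_sum id (map_prod id \<sigma>)"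

lemma relabel_simps [simp]:
  "relabel \<sigma> (Inl v) = Inl v" "relabel \<sigma> (Inr (v, i)) = Inr (v, \<sigma> i)"
  by (simp_all add: relabel_def)

lemma relabel_eq_Inl_iff [simp]: "relabel \<sigma> w = Inl v \<longleftrightarrow> w = Inl v"
  and relabel_eq_Inr_iff: "relabel \<sigma> w = Inr (v, j) \<longleftrightarrow> (\<exists>i. w = Inr (v, i) \<and> \<sigma> i = j)"
  by (cases w; auto)+

lemma map_relabel_eq_map_Inl_iff [simp]: "map (relabel \<sigma>) ws = map Inl vs \<longleftrightarrow> ws = map Inl vs"
  by (induction ws arbitrary: vs) (auto simp: Cons_eq_map_conv)

lemma relabel_in_verts_attach:
  "\<sigma> \<in> {..<N} \<rightarrow> {..<n} \<Longrightarrow> w \<in> verts (attach N A) \<Longrightarrow> relabel \<sigma> w \<in> verts (attach n A)"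
  by (cases w) auto

lemma inj_on_relabel:
  assumes "inj_on \<sigma> {..<N}"
  shows "inj_on (relabel \<sigma>) (verts (attach N A))"
proof (rule inj_onI)
  fix u w assume "u \<in> verts (attach N A)" "w \<in> verts (attach N A)" "relabel \<sigma> u = relabel \<sigma> w"
  then show "u = w"
    using inj_onD[OF assms] by (cases u; cases w) auto
qed

lemma map_relabel_in_interp_iff:
  assumes \<sigma>: "\<sigma> \<in> {..<N} \<rightarrow> {..<n}" and ws: "set ws \<subseteq> verts (attach N A)"
  shows "map (relabel \<sigma>) ws \<in> interp (attach n A) R \<longleftrightarrow> ws \<in> interp (attach N A) R"
proof -
  have "(\<exists>v\<in>verts A. \<exists>i<n. map (relabel \<sigma>) ws = [Inl v, Inr (v, i)] \<or>
        map (relabel \<sigma>) ws = [Inr (v, i), Inl v]) \<longleftrightarrow>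
      (\<exists>v\<in>verts A. \<exists>i<N. ws = [Inl v, Inr (v, i)] \<or> ws = [Inr (v, i), Inl v])"
    using assms by (auto simp: map_eq_Cons_conv relabel_eq_Inr_iff)
  moreover have "(\<exists>v\<in>verts A. \<exists>i<n. map (relabel \<sigma>) ws = [Inr (v, i)]) \<longleftrightarrow>
      (\<exists>v\<in>verts A. \<exists>i<N. ws = [Inr (v, i)])"
    using assms by (auto simp: map_eq_Cons_conv relabel_eq_Inr_iff)
  ultimately show ?thesis by (simp add: in_interp_attach_iff)
qed

lemma relabel_onto_vertex:
  assumes \<sigma>: "\<sigma> \<in> {..<N} \<rightarrow> {..<n}" "inj_on \<sigma> {..<N}"
    and X: "finite X" "card X < N" and w: "w \<in> verts (attach n A)"
  obtains \<tau> u where "\<tau> \<in> {..<N} \<rightarrow> {..<n}" "inj_on \<tau> {..<N}" "u \<in> verts (attach N A)"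
    "relabel \<tau> u = w" "\<And>y. y \<in> X \<Longrightarrow> relabel \<tau> (e y) = relabel \<sigma> (e y)"
proof -
  consider (base) v where "w = Inl v" "v \<in> verts A"
    | (old) v i where "w = Inr (v, \<sigma> i)" "v \<in> verts A" "i < N"
    | (new) v j where "w = Inr (v, j)" "v \<in> verts A" "j < n" "j \<notin> \<sigma> ` {..<N}"
  proof (cases w)
    case (Inr vj)
    then obtain v j where "w = Inr (v, j)" "v \<in> verts A" "j < n" using w by (cases vj) auto
    then show ?thesis using old new by (cases "j \<in> \<sigma> ` {..<N}") auto
  qed (use base w in auto)
  then show ?thesis
  proof cases
    case base
    then show ?thesis using that[of \<sigma> "Inl v"] \<sigma> by simp
  next
    case old
    then show ?thesis using that[of \<sigma> "Inr (v, i)"] \<sigma> by simp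
  next
    case new
    obtain i where i: "i < N" "i \<notin> (\<lambda>y. snd (projr (e y))) ` X"
      using ex_less_notin_image[OF X] by blast
    let ?\<tau> = "\<sigma>(i := j)"
    show ?thesis
    proof (rule that)
      show "?\<tau> \<in> {..<N} \<rightarrow> {..<n}" using \<sigma>(1) new(3) by auto
      show "inj_on ?\<tau> {..<N}" by (rule inj_on_fun_updI[OF \<sigma>(2) new(4)])
      show "Inr (v, i) \<in> verts (attach N A)" using new(2) i(1) by simp
      show "relabel ?\<tau> (Inr (v, i)) = w" by (simp add: new(1))
      show "relabel ?\<tau> (e y) = relabel \<sigma> (e y)" if "y \<in> X" for y
        using imageI[OF that, of "\<lambda>y. snd (projr (e y))"] i(2) by (cases "e y") auto
    qed
  qed
qed

text \<open>A new position occurring as a witness in \<open>attach n A\<close> is brought into the range of the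
  embedding by redirecting a position that the assignment does not use.\<close>

lemma sat_relabel_Ex:
  assumes \<sigma>: "\<sigma> \<in> {..<N} \<rightarrow> {..<n}" "inj_on \<sigma> {..<N}" and card_vars: "card (vars (Ex x \<phi>)) \<le> N"
    and sat_upd: "\<And>\<tau> u. \<tau> \<in> {..<N} \<rightarrow> {..<n} \<Longrightarrow> inj_on \<tau> {..<N} \<Longrightarrow> u \<in> verts (attach N A) \<Longrightarrow>
      sat (attach n A) (relabel \<tau> \<circ> e(x := u)) \<phi> \<longleftrightarrow> sat (attach N A) (e(x := u)) \<phi>"
  shows "sat (attach n A) (relabel \<sigma> \<circ> e) (Ex x \<phi>) \<longleftrightarrow> sat (attach N A) e (Ex x \<phi>)"
proof
  assume "sat (attach n A) (relabel \<sigma> \<circ> e) (Ex x \<phi>)"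
  then obtain w where w: "w \<in> verts (attach n A)"
    and sat_w: "sat (attach n A) ((relabel \<sigma> \<circ> e)(x := w)) \<phi>" by auto
  have "card (free_vars (Ex x \<phi>)) < N" using card_free_vars_Ex_less[of x \<phi>] card_vars by simp
  then obtain \<tau> u where \<tau>: "\<tau> \<in> {..<N} \<rightarrow> {..<n}" "inj_on \<tau> {..<N}"
    and u: "u \<in> verts (attach N A)" "relabel \<tau> u = w"
    and agree: "\<And>y. y \<in> free_vars (Ex x \<phi>) \<Longrightarrow> relabel \<tau> (e y) = relabel \<sigma> (e y)"
    using relabel_onto_vertex[OF \<sigma> finite_free_vars _ w] by metis
  have "sat (attach n A) (relabel \<tau> \<circ> e(x := u)) \<phi> \<longleftrightarrow>
      sat (attach n A) ((relabel \<sigma> \<circ> e)(x := w)) \<phi>"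
    by (rule sat_cong) (use u(2) agree in auto)
  then show "sat (attach N A) e (Ex x \<phi>)" using sat_w sat_upd[OF \<tau> u(1)] u(1) by auto
next
  assume "sat (attach N A) e (Ex x \<phi>)"
  then obtain u where u: "u \<in> verts (attach N A)" "sat (attach N A) (e(x := u)) \<phi>" by auto
  then have "sat (attach n A) ((relabel \<sigma> \<circ> e)(x := relabel \<sigma> u)) \<phi>"
    using sat_upd[OF \<sigma>] by (simp add: fun_upd_comp)
  then show "sat (attach n A) (relabel \<sigma> \<circ> e) (Ex x \<phi>)"
    using relabel_in_verts_attach[OF \<sigma>(1) u(1)] by auto
qed

lemma sat_relabel:
  assumes "\<sigma> \<in> {..<N} \<rightarrow> {..<n}" and "inj_on \<sigma> {..<N}" and "card (vars \<phi>) \<le> N"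
    and "e ` free_vars \<phi> \<subseteq> verts (attach N A)"
  shows "sat (attach n A) (relabel \<sigma> \<circ> e) \<phi> \<longleftrightarrow> sat (attach N A) e \<phi>"
  using assms
proof (induction \<phi> arbitrary: \<sigma> e)
  case (Eq x y)
  then show ?case using inj_on_eq_iff[OF inj_on_relabel] by force
next
  case (Rel R xs)
  then show ?case using map_relabel_in_interp_iff[OF Rel.prems(1), of "map e xs"]
    by (simp add: comp_def)
next
  case (Neg \<phi>)
  then show ?case by simp
next
  case (Conj \<phi> \<psi>)
  have "card (vars \<phi>) \<le> card (vars (Conj \<phi> \<psi>))" "card (vars \<psi>) \<le> card (vars (Conj \<phi> \<psi>))"
    by (simp_all add: card_mono)
  then show ?case using Conj by (simp add: image_Un)
next
  case (Ex x \<phi>)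
  have "card (vars \<phi>) \<le> card (vars (Ex x \<phi>))" by (simp add: card_insert_le)
  then have "card (vars \<phi>) \<le> N" using Ex.prems(3) by simp
  then show ?case
    by (intro sat_relabel_Ex Ex.prems(1-3) Ex.IH) (use Ex.prems(4) in auto)
qed

end

subsection \<open>Eliminating boundedly many leaf positions\<close>

primrec copy :: "'a \<Rightarrow> nat option \<Rightarrow> 'a + 'a \<times> nat" where
  "copy v None = Inl v"
| "copy v (Some i) = Inr (v, i)"

lemma copy_eq_iff [simp]: "copy v i = copy w j \<longleftrightarrow> v = w \<and> i = j"
  by (cases i; cases j) auto

lemma copy_eq_Inl_iff: "copy v j = Inl w \<longleftrightarrow> v = w \<and> j = None"
  by (cases j) auto

lemma fun_upd_copy:
  "(\<lambda>y. copy (r y) (k y))(x := copy v j) = (\<lambda>y. copy ((r(x := v)) y) ((k(x := j)) y))"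
  by auto

lemma bex_map_copy_eq_map_Inl_iff:
  "(\<exists>vs\<in>V. map (\<lambda>x. copy (r x) (k x)) xs = map Inl vs) \<longleftrightarrow>
    (\<forall>x\<in>set xs. k x = None) \<and> map r xs \<in> V"
proof -
  have "map (\<lambda>x. copy (r x) (k x)) xs = map Inl vs \<longleftrightarrow>
      (\<forall>x\<in>set xs. k x = None) \<and> map r xs = vs" for vs
    by (induction xs arbitrary: vs) (auto simp: Cons_eq_map_conv copy_eq_Inl_iff)
  then show ?thesis by auto
qed

context leaf_language
begin

lemma verts_attach_eq_copies:
  "verts (attach N A) = (\<Union>v\<in>verts A. copy v ` set (None # map Some [0..<N]))"
proof
  show "verts (attach N A) \<subseteq> (\<Union>v\<in>verts A. copy v ` set (None # map Some [0..<N]))"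
    by (force simp: attach_leaves_def image_iff)
qed auto

primrec project :: "nat \<Rightarrow> 'r fm \<Rightarrow> (nat \<Rightarrow> nat option) \<Rightarrow> 'r fm" where
  "project N (Eq x y) k = (if k x = k y then Eq x y else Falsum)"
| "project N (Rel R xs) k =
    (if R = M then if k (hd xs) = None then Falsum else Neg Falsum
     else if R \<in> L \<and> (\<forall>x\<in>set xs. k x = None) then Rel R xs
     else if R = E \<and> (k (hd xs) = None) \<noteq> (k (last xs) = None) then Eq (hd xs) (last xs)
     else Falsum)"
| "project N (Neg \<phi>) k = Neg (project N \<phi> k)"
| "project N (Conj \<phi> \<psi>) k = Conj (project N \<phi> k) (project N \<psi> k)"
| "project N (Ex x \<phi>) k =
    Ex x (Disj (map (\<lambda>j. project N \<phi> (k(x := j))) (None # map Some [0..<N])))"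

lemma formula_of_project: "formula_of (L \<union> {E, M}) ar \<phi> \<Longrightarrow> formula_of L ar (project N \<phi> k)"
  by (induction \<phi> arbitrary: k) auto

lemma free_vars_project:
  "formula_of (L \<union> {E, M}) ar \<phi> \<Longrightarrow> free_vars (project N \<phi> k) \<subseteq> free_vars \<phi>"
proof (induction \<phi> arbitrary: k)
  case (Rel R xs)
  then have "xs \<noteq> []" if "R = E" using that ar_E by auto
  then show ?case by auto
next
  case (Conj \<phi> \<psi>)
  then show ?case by (simp add: le_supI1 le_supI2)
next
  case (Ex x \<phi>)
  then show ?case by auto
qed simp_all

lemma sat_project_Rel:
  assumes "formula_of (L \<union> {E, M}) ar (Rel R xs)"
    and verts: "\<And>x. x \<in> set xs \<Longrightarrow> copy (r x) (k x) \<in> verts (attach N A)"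
  shows "map (\<lambda>x. copy (r x) (k x)) xs \<in> interp (attach N A) R \<longleftrightarrow>
    sat A r (project N (Rel R xs) k)"
proof -
  consider (mark) "R = M" | (edge) "R = E" | (base) "R \<in> L" "R \<noteq> E" using assms(1) by auto
  then show ?thesis
  proof cases
    case mark
    then obtain x where xs_eq: "xs = [x]" using assms(1) ar_M by (auto simp: length_Suc_conv)
    show ?thesis
      using mark xs_eq verts[of x] M_notin_L E_neq_M
      by (cases "k x") (auto simp: in_interp_attach_iff)
  next
    case edge
    then obtain x y where xs_eq: "xs = [x, y]"
      using assms(1) ar_E by (auto simp: length_Suc_conv numeral_2_eq_2)
    show ?thesis
      using edge xs_eq verts[of x] verts[of y] E_neq_M
      by (cases "k x"; cases "k y") (auto simp: in_interp_attach_iff Cons_eq_map_conv)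
  next
    case base
    then show ?thesis
      using M_notin_L by (auto simp: in_interp_attach_iff bex_map_copy_eq_map_Inl_iff)
  qed
qed

lemma sat_project:
  assumes "formula_of (L \<union> {E, M}) ar \<phi>"
    and "\<And>x. x \<in> free_vars \<phi> \<Longrightarrow> copy (r x) (k x) \<in> verts (attach N A)"
  shows "sat (attach N A) (\<lambda>x. copy (r x) (k x)) \<phi> \<longleftrightarrow> sat A r (project N \<phi> k)"
  using assms
proof (induction \<phi> arbitrary: r k)
  case (Rel R xs)
  then show ?case unfolding sat.simps by (intro sat_project_Rel) simp_all
next
  case (Ex x \<phi>)
  let ?J = "set (None # map Some [0..<N])"
  have sat_upd: "sat (attach N A) ((\<lambda>y. copy (r y) (k y))(x := copy v j)) \<phi> \<longleftrightarrow>
      sat A (r(x := v)) (project N \<phi> (k(x := j)))" if v: "v \<in> verts A" and j: "j \<in> ?J" for v j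
    unfolding fun_upd_copy
  proof (rule Ex.IH)
    show "copy ((r(x := v)) y) ((k(x := j)) y) \<in> verts (attach N A)" if "y \<in> free_vars \<phi>" for y
      using Ex.prems(2)[of y] that v j by auto
  qed (use Ex.prems in simp)
  have "sat (attach N A) (\<lambda>y. copy (r y) (k y)) (Ex x \<phi>) \<longleftrightarrow>
      (\<exists>v\<in>verts A. \<exists>j\<in>?J. sat (attach N A) ((\<lambda>y. copy (r y) (k y))(x := copy v j)) \<phi>)"
    unfolding sat.simps verts_attach_eq_copies by simp
  also have "\<dots> \<longleftrightarrow> (\<exists>v\<in>verts A. \<exists>j\<in>?J. sat A (r(x := v)) (project N \<phi> (k(x := j))))"
    by (intro bex_cong refl sat_upd)
  also have "\<dots> \<longleftrightarrow> sat A r (project N (Ex x \<phi>) k)"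
    by simp
  finally show ?case .
qed simp_all

text \<open>Every free variable \<open>x\<close> is placed on the leaf at position \<open>x \<le> p\<close>.\<close>

definition leaf_elimination :: "nat \<Rightarrow> 'r fm \<Rightarrow> 'r fm" where
  "leaf_elimination p \<phi> = project (max (Suc p) (card (vars \<phi>))) \<phi> Some"

lemma leaf_elimination_in_FO:
  "\<phi> \<in> FO (L \<union> {E, M}) ar p \<Longrightarrow> leaf_elimination p \<phi> \<in> FO L ar p"
  using formula_of_project free_vars_project unfolding FO_def leaf_elimination_def by blast

lemma reads_bases_leaf_elimination:
  assumes \<phi>: "\<phi> \<in> FO (L \<union> {E, M}) ar p" and n: "max (Suc p) (card (vars \<phi>)) \<le> n"
  shows "reads_bases p n A \<phi> (leaf_elimination p \<phi>)"
  unfolding reads_bases_def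
proof (intro ballI)
  fix r k assume r: "r \<in> {1..p} \<rightarrow>\<^sub>E verts A" and "k \<in> distinct_positions p n"
  then have k: "inj_on k {1..p}" "k \<in> {1..p} \<rightarrow> {..<n}" by (auto simp: distinct_positions_def)
  define N where "N = max (Suc p) (card (vars \<phi>))"
  have fv: "free_vars \<phi> \<subseteq> {1..p}" and lang: "formula_of (L \<union> {E, M}) ar \<phi>"
    using \<phi> by (simp_all add: FO_def)
  have verts: "copy (r x) (Some x) \<in> verts (attach N A)" if "x \<in> free_vars \<phi>" for x
    using that fv r by (force simp: N_def)
  have "{1..p} \<subseteq> {..<N}" and "card {..<N} \<le> card {..<n}" using n by (auto simp: N_def)
  then obtain \<sigma> where \<sigma>: "inj_on \<sigma> {..<N}" "\<sigma> \<in> {..<N} \<rightarrow> {..<n}" "\<And>x. x \<in> {1..p} \<Longrightarrow> \<sigma> x = k x"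
    using inj_on_extend[OF k] by (metis finite_lessThan)
  have "sat (attach n A) (leaf_tuple p r k) \<phi> \<longleftrightarrow>
      sat (attach n A) (relabel \<sigma> \<circ> (\<lambda>x. copy (r x) (Some x))) \<phi>"
    by (rule sat_cong) (use fv \<sigma>(3) in \<open>auto simp: leaf_tuple_def\<close>)
  also have "\<dots> \<longleftrightarrow> sat (attach N A) (\<lambda>x. copy (r x) (Some x)) \<phi>"
    by (rule sat_relabel) (use \<sigma> verts in \<open>auto simp: N_def\<close>)
  also have "\<dots> \<longleftrightarrow> sat A r (leaf_elimination p \<phi>)"
    unfolding leaf_elimination_def N_def[symmetric] by (rule sat_project[OF lang verts])
  finally show "sat (attach n A) (leaf_tuple p r k) \<phi> \<longleftrightarrow> sat A r (leaf_elimination p \<phi>)" .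
qed

end

subsection \<open>Convergence of pairings\<close>

lemma pairing_Neg:
  assumes "finite (verts A)" and "verts A \<noteq> {}"
  shows "pairing p (Neg \<phi>) A = 1 - pairing p \<phi> A"
proof -
  let ?X = "{1..p} \<rightarrow>\<^sub>E verts A" and ?S = "{t \<in> {1..p} \<rightarrow>\<^sub>E verts A. sat A t \<phi>}"
  have tuples: "finite ?X" "?X \<noteq> {}" using assms by (auto intro: finite_PiE simp: PiE_eq_empty_iff)
  have "{t \<in> ?X. sat A t (Neg \<phi>)} = ?X - ?S" by auto
  moreover have "finite ?S" "card ?S \<le> card ?X" using tuples(1) by (auto intro: card_mono)
  then have "real (card (?X - ?S)) = real (card ?X) - real (card ?S)"
    by (subst card_Diff_subset) (auto simp: of_nat_diff)
  moreover have "card ?X > 0" using tuples by (simp add: card_gt_0_iff)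
  ultimately show ?thesis by (simp add: pairing_def diff_divide_distrib)
qed

lemma pairing_nonneg: "0 \<le> pairing p \<phi> A"
  by (simp add: pairing_def)

lemma pairing_le_1: "finite (verts A) \<Longrightarrow> verts A \<noteq> {} \<Longrightarrow> pairing p \<phi> A \<le> 1"
  using pairing_Neg[of A p \<phi>] pairing_nonneg[of p "Neg \<phi>" A] by simp

definition leaf_tuple_fraction :: "nat \<Rightarrow> nat \<Rightarrow> real" where
  "leaf_tuple_fraction p n = real (card (distinct_positions p n)) / real (Suc n) ^ p"

lemma leaf_tuple_fraction_eq_prod:
  "leaf_tuple_fraction p n = (\<Prod>i<p. real (n - i) / real (Suc n))"
proof -
  have "card (distinct_positions p n) = (\<Prod>i<p. n - i)"
    using card_inj_on_subset_funcset[of "{1..p}" "{..<n}" "{1..p}"]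
    by (simp add: distinct_positions_def atLeast0LessThan)
  then show ?thesis by (simp add: leaf_tuple_fraction_def prod_dividef)
qed

lemma leaf_tuple_fraction_le_1: "leaf_tuple_fraction p n \<le> 1"
  unfolding leaf_tuple_fraction_eq_prod by (rule prod_le_1) auto

lemma leaf_tuple_fraction_tendsto_1: "leaf_tuple_fraction p \<longlonglongrightarrow> 1"
proof -
  have "(\<lambda>n. real (n - i) / real (Suc n)) \<longlonglongrightarrow> 1" for i
  proof (rule Lim_transform_eventually)
    have "(\<lambda>n. 1 - (real i + 1) * inverse (real (Suc n))) \<longlonglongrightarrow> 1 - (real i + 1) * 0"
      by (intro tendsto_intros LIMSEQ_inverse_real_of_nat)
    then show "(\<lambda>n. 1 - (real i + 1) * inverse (real (Suc n))) \<longlonglongrightarrow> 1" by simp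
    show "\<forall>\<^sub>F n in sequentially.
        1 - (real i + 1) * inverse (real (Suc n)) = real (n - i) / real (Suc n)"
      using eventually_ge_at_top[of i]
      by eventually_elim (simp add: of_nat_diff field_simps)
  qed
  then have "(\<lambda>n. \<Prod>i<p. real (n - i) / real (Suc n)) \<longlonglongrightarrow> (\<Prod>i<p. 1)"
    by (intro tendsto_prod)
  then show ?thesis by (simp add: leaf_tuple_fraction_eq_prod[abs_def])
qed

context leaf_language
begin

lemma reads_bases_Neg: "reads_bases p n A \<psi> \<phi> \<Longrightarrow> reads_bases p n A (Neg \<psi>) (Neg \<phi>)"
  by (simp add: reads_bases_def)

lemma card_leaf_tuples_le:
  assumes fin: "finite (verts A)" and reads: "reads_bases p n A \<psi> \<phi>"
  shows "card {r \<in> {1..p} \<rightarrow>\<^sub>E verts A. sat A r \<phi>} * card (distinct_positions p n)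
    \<le> card {t \<in> {1..p} \<rightarrow>\<^sub>E verts (attach n A). sat (attach n A) t \<psi>}"
    (is "card ?S * card ?K \<le> card ?T")
proof -
  let ?leaves = "\<lambda>(r, k). leaf_tuple p r k"
  have "inj_on ?leaves (({1..p} \<rightarrow>\<^sub>E verts A) \<times> ({1..p} \<rightarrow>\<^sub>E {..<n}))"
    by (rule inj_on_leaf_tuple)
  then have "inj_on ?leaves (?S \<times> ?K)"
    by (rule inj_on_subset) (auto simp: distinct_positions_def)
  then have "card ?S * card ?K = card (?leaves ` (?S \<times> ?K))"
    by (simp add: card_image card_cartesian_product)
  also have "\<dots> \<le> card ?T"
  proof (rule card_mono)
    have "finite (verts (attach n A))" using fin by (simp add: attach_leaves_def)
    then show "finite ?T" by (simp add: finite_PiE)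
    show "?leaves ` (?S \<times> ?K) \<subseteq> ?T"
    proof clarify
      fix r k assume r: "r \<in> {1..p} \<rightarrow>\<^sub>E verts A" "sat A r \<phi>" and k: "k \<in> distinct_positions p n"
      have "leaf_tuple p r k \<in> {1..p} \<rightarrow>\<^sub>E verts (attach n A)"
        by (rule leaf_tuple_in_verts) (use r k in \<open>simp_all add: distinct_positions_def\<close>)
      then show "leaf_tuple p r k \<in> {1..p} \<rightarrow>\<^sub>E verts (attach n A) \<and>
          sat (attach n A) (leaf_tuple p r k) \<psi>"
        using reads r k by (simp add: reads_bases_def)
    qed
  qed
  finally show ?thesis .
qed

lemma pairing_attach_ge:
  assumes "finite (verts A)" and "reads_bases p n A \<psi> \<phi>"
  shows "leaf_tuple_fraction p n * pairing p \<phi> A \<le> pairing p \<psi> (attach n A)"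
proof -
  have card_tuples: "card ({1..p} \<rightarrow>\<^sub>E verts (attach n A)) = card ({1..p} \<rightarrow>\<^sub>E verts A) * Suc n ^ p"
    by (simp add: card_PiE card_verts_attach power_mult_distrib del: mult_Suc_right)
  have "leaf_tuple_fraction p n * pairing p \<phi> A =
      real (card {r \<in> {1..p} \<rightarrow>\<^sub>E verts A. sat A r \<phi>} * card (distinct_positions p n)) /
      real (card ({1..p} \<rightarrow>\<^sub>E verts (attach n A)))"
    by (simp only: card_tuples pairing_def leaf_tuple_fraction_def of_nat_mult of_nat_power
        times_divide_times_eq mult.commute)
  also have "\<dots> \<le> pairing p \<psi> (attach n A)"
    unfolding pairing_def
    by (intro divide_right_mono of_nat_mono card_leaf_tuples_le assms) simp
  finally show ?thesis .
qed

lemma abs_pairing_attach_diff_le: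
  assumes verts_A: "finite (verts A)" "verts A \<noteq> {}" and reads: "reads_bases p n A \<psi> \<phi>"
  shows "\<bar>pairing p \<psi> (attach n A) - pairing p \<phi> A\<bar> \<le> 1 - leaf_tuple_fraction p n"
proof -
  let ?a = "pairing p \<phi> A" and ?b = "pairing p \<psi> (attach n A)" and ?q = "leaf_tuple_fraction p n"
  have verts_B: "finite (verts (attach n A))" "verts (attach n A) \<noteq> {}"
    using verts_A by (simp_all add: attach_leaves_def)
  have "?q * ?a \<le> ?b"
    by (rule pairing_attach_ge[OF verts_A(1) reads])
  moreover have "?q * (1 - ?a) \<le> 1 - ?b"
    using pairing_attach_ge[OF verts_A(1) reads_bases_Neg[OF reads]]
    by (simp only: pairing_Neg[OF verts_A] pairing_Neg[OF verts_B])
  moreover have "(1 - ?q) * ?a \<le> 1 - ?q" "(1 - ?q) * (1 - ?a) \<le> 1 - ?q"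
    using leaf_tuple_fraction_le_1[of p n] pairing_nonneg[of p \<phi> A] pairing_le_1[OF verts_A, of p \<phi>]
    by (auto intro!: mult_left_le)
  ultimately show ?thesis by (simp add: algebra_simps abs_le_iff)
qed

lemma convergent_pairing_attach_iff:
  assumes verts_A: "\<And>n. finite (verts (A n))" "\<And>n. verts (A n) \<noteq> {}"
    and reads: "\<forall>\<^sub>F n in sequentially. reads_bases p n (A n) \<psi> \<phi>"
  shows "convergent (\<lambda>n. pairing p \<psi> (attach n (A n))) \<longleftrightarrow> convergent (\<lambda>n. pairing p \<phi> (A n))"
proof -
  have "(\<lambda>n. pairing p \<psi> (attach n (A n)) - pairing p \<phi> (A n)) \<longlonglongrightarrow> 0"
  proof (rule tendsto_0_le)
    show "\<forall>\<^sub>F n in sequentially. norm (pairing p \<psi> (attach n (A n)) - pairing p \<phi> (A n))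
        \<le> norm (1 - leaf_tuple_fraction p n) * 1"
      using reads
    proof eventually_elim
      case (elim n)
      show ?case
        using abs_pairing_attach_diff_le[OF verts_A elim] leaf_tuple_fraction_le_1[of p n] by simp
    qed
    show "(\<lambda>n. 1 - leaf_tuple_fraction p n) \<longlonglongrightarrow> 0"
      using tendsto_diff[OF tendsto_const leaf_tuple_fraction_tendsto_1, of 1 p] by simp
  qed
  then show ?thesis by (simp add: convergent_def Lim_transform_eq)
qed

lemma convergent_pairing_leaf_elimination_iff:
  assumes "\<And>n. finite (verts (A n))" "\<And>n. verts (A n) \<noteq> {}" and "\<psi> \<in> FO (L \<union> {E, M}) ar p"
  shows "convergent (\<lambda>n. pairing p (leaf_elimination p \<psi>) (A n)) \<longleftrightarrow>
    convergent (\<lambda>n. pairing p \<psi> (attach n (A n)))"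
  by (rule convergent_pairing_attach_iff[symmetric, OF assms(1,2)])
    (rule eventually_mono[OF eventually_ge_at_top reads_bases_leaf_elimination[OF assms(3)]])

lemma convergent_pairing_base_formula_iff:
  assumes "\<And>n. finite (verts (A n))" "\<And>n. verts (A n) \<noteq> {}" and "\<phi> \<in> FO L ar p"
  shows "convergent (\<lambda>n. pairing p (base_formula p \<phi>) (attach n (A n))) \<longleftrightarrow>
    convergent (\<lambda>n. pairing p \<phi> (A n))"
  by (intro convergent_pairing_attach_iff always_eventually allI reads_bases_base_formula assms)

end

theorem proposition7p1:
  fixes L :: "'r set" and ar :: "'r \<Rightarrow> nat" and E M :: 'r
    and p :: nat and A :: "nat \<Rightarrow> ('a, 'r) rel_struct"
  assumes "\<forall>R\<in>L. 0 < ar R"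
    and "ar E = 2" and "ar M = 1" and "M \<notin> L"
    and "\<And>n. finite_struct L ar (A n)"
  shows "FO_convergent L ar p A \<longleftrightarrow>
         FO_convergent (L \<union> {E, M}) ar p (\<lambda>n. attach_leaves L E M n (A n))"
proof -
  interpret leaf_language L ar E M using assms(2-4) by unfold_locales
  have verts_A: "finite (verts (A n))" "verts (A n) \<noteq> {}" for n
    using assms(5) by (simp_all add: finite_struct_def)
  show ?thesis
    unfolding FO_convergent_def
  proof (intro iffI ballI)
    show "convergent (\<lambda>n. pairing p \<psi> (attach n (A n)))"
      if "\<forall>\<phi>\<in>FO L ar p. convergent (\<lambda>n. pairing p \<phi> (A n))" "\<psi> \<in> FO (L \<union> {E, M}) ar p" for \<psi>
      using that convergent_pairing_leaf_elimination_iff[of A, OF verts_A] leaf_elimination_in_FO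
      by blast
    show "convergent (\<lambda>n. pairing p \<phi> (A n))"
      if "\<forall>\<psi>\<in>FO (L \<union> {E, M}) ar p. convergent (\<lambda>n. pairing p \<psi> (attach n (A n)))"
        "\<phi> \<in> FO L ar p" for \<phi>
      using that convergent_pairing_base_formula_iff[of A, OF verts_A] base_formula_in_FO by blast
  qed
qed

end
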